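(* Let $X$ be a bounded lattice on which a group $G$ acts by lattice automorphisms. Let $A$ be a commutative ring with identity and let $B$ be an $A$-module, on which $G$ is taken to act trivially. Then there are isomorphisms of $A$-modules \[ \mathcal{M}(X,B)\cong\operatorname{Hom}_{\mathbb{Z}}(\mathbb{Z}[X]/I,B)\cong\operatorname{Hom}_A(A[X]/I_A,B), \] \[ \mathcal{M}(X,B;G)\cong\operatorname{Hom}_{\mathbb{Z}}(\mathbb{Z}[X]/I,B)^G\cong\operatorname{Hom}_A(A[X]/I_A,B)^G. \]
   Context: All rings are commutative with identity. A bounded lattice has a least element $0_X$ and a greatest element $1_X$. A ($B$-valued) measure on $X$ is a function $\nu:X\to B$ with $\nu(0_X)=0$ and, for all $k\ge 2$ and all $x_1,\dots,x_k\in X$, \[ \nu(x_1\vee\dots\vee x_k)=\sum_{s=1}^k(-1)^{s+1}\sum_{1\leq i_1<\dots<i_s\leq k}\nu(x_{i_1}\wedge\dots\wedge x_{i_s}). \] $\mathcal{M}(X,B)$ is the $A$-module of all $B$-valued measures on $X$ (pointwise operations), and $\mathcal{M}(X,B;G)$ is the submodule of $G$-invariant measures ($\nu(gx)=\nu(x)$ for all $g\in G$, $x\in X$). $\mathbb{Z}[X]$ is the polynomial ring with one variable for each element of $X$, and $I\subseteq\mathbb{Z}[X]$ is the ideal generated by $0_X$, $1_X-1$, and $x\wedge y-xy$, $x\vee y-x-y+xy$ for all $x,y\in X$. $I_A$ is the ideal of $A[X]$ generated by the image of $I$. The action of $G$ on $X$ induces an action on $\mathbb{Z}[X]/I$ and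 $A[X]/I_A$ by ring automorphisms. $G$ acts on the Hom groups by $(g\varphi)(m)=g\,\varphi(g^{-1}m)=\varphi(g^{-1}m)$, and $(-)^G$ denotes the subgroup of $G$-fixed elements. $\operatorname{Hom}_{\mathbb{Z}}(\mathbb{Z}[X]/I,B)$ is an $A$-module through the $A$-module structure of $B$. *)

theory Defs
  imports
    Complex_Main
    "HOL-Library.Poly_Mapping"
    "HOL-Library.Function_Algebras"
    "HOL-Algebra.Group_Action"
begin

section \<open>Commutative rings with identity, ideals and modules\<close>

text \<open>
  The library class \<^class>\<open>comm_ring_1\<close> contains the axiom \<open>0 \<noteq> 1\<close>, and the library notions of
  module and of integer multiples of \<open>1\<close> are built on it. The zero ring is not to be excluded:
  it is an admissible ring of scalars, and the ring \<open>\<int>[X]/I\<close> below is the zero ring if \<open>X\<close> has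
  only one element. Hence the following variants, which agree with the library
  notions on \<^class>\<open>comm_ring_1\<close>.
\<close>

class comm_unital_ring = comm_ring + comm_monoid_mult

subclass (in comm_ring_1) comm_unital_ring ..

definition int_embed :: "int \<Rightarrow> 'a::comm_unital_ring" where
  "int_embed n = (\<Sum>i<nat n. 1) - (\<Sum>i<nat (- n). 1)"

lemma int_embed_eq_of_int: "int_embed n = (of_int n :: 'a::comm_ring_1)"
  by (cases "n \<ge> 0") (auto simp: int_embed_def)

locale unital_module =
  fixes scale :: "'a::comm_unital_ring \<Rightarrow> 'b::ab_group_add \<Rightarrow> 'b"
  assumes scale_right_distrib: "scale a (x + y) = scale a x + scale a y"
    and scale_left_distrib: "scale (a + b) x = scale a x + scale b x"
    and scale_scale: "scale a (scale b x) = scale (a * b) x"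
    and scale_one: "scale 1 x = x"

lemma unital_module_iff_module:
  "unital_module (scale :: 'a::comm_ring_1 \<Rightarrow> 'b::ab_group_add \<Rightarrow> 'b) \<longleftrightarrow> module scale"
  by (auto simp: unital_module_def module_def)

definition is_submodule :: "('a::comm_unital_ring \<Rightarrow> 'b::ab_group_add \<Rightarrow> 'b) \<Rightarrow> 'b set \<Rightarrow> bool" where
  "is_submodule scale S \<longleftrightarrow>
    unital_module scale \<and> 0 \<in> S \<and> (\<forall>x\<in>S. \<forall>y\<in>S. x + y \<in> S) \<and> (\<forall>a. \<forall>x\<in>S. scale a x \<in> S)"

definition module_isomorphic ::
  "('a::comm_unital_ring \<Rightarrow> 'b::ab_group_add \<Rightarrow> 'b) \<Rightarrow> 'b set \<Rightarrow>
   ('a \<Rightarrow> 'c::ab_group_add \<Rightarrow> 'c) \<Rightarrow> 'c set \<Rightarrow> bool" where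
  "module_isomorphic scale1 S scale2 T \<longleftrightarrow>
    is_submodule scale1 S \<and> is_submodule scale2 T \<and>
    (\<exists>f. bij_betw f S T \<and>
         (\<forall>x\<in>S. \<forall>y\<in>S. f (x + y) = f x + f y) \<and>
         (\<forall>a. \<forall>x\<in>S. f (scale1 a x) = scale2 a (f x)))"

definition pointwise :: "('a \<Rightarrow> 'b \<Rightarrow> 'b) \<Rightarrow> 'a \<Rightarrow> ('c \<Rightarrow> 'b) \<Rightarrow> 'c \<Rightarrow> 'b" where
  "pointwise scale a f = (\<lambda>x. scale a (f x))"

definition is_ideal :: "'r::comm_ring set \<Rightarrow> bool" where
  "is_ideal J \<longleftrightarrow> 0 \<in> J \<and> (\<forall>p\<in>J. \<forall>q\<in>J. p - q \<in> J) \<and> (\<forall>r. \<forall>p\<in>J. r * p \<in> J)"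

lemma is_ideal_hull: "is_ideal (is_ideal hull S)"
  by (rule hull_in) (auto simp: is_ideal_def)

lemma is_ideal_zero: "is_ideal J \<Longrightarrow> 0 \<in> J"
  and is_ideal_diff: "is_ideal J \<Longrightarrow> p \<in> J \<Longrightarrow> q \<in> J \<Longrightarrow> p - q \<in> J"
  and is_ideal_mult: "is_ideal J \<Longrightarrow> p \<in> J \<Longrightarrow> r * p \<in> J"
  by (auto simp: is_ideal_def)

lemma is_ideal_uminus: "is_ideal J \<Longrightarrow> p \<in> J \<Longrightarrow> - p \<in> J"
  using is_ideal_diff[OF _ is_ideal_zero, of J p] by simp

lemma is_ideal_add: "is_ideal J \<Longrightarrow> p \<in> J \<Longrightarrow> q \<in> J \<Longrightarrow> p + q \<in> J"
  using is_ideal_diff[OF _ _ is_ideal_uminus, of J p q] by simp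


section \<open>Measures on a bounded lattice\<close>

text \<open>The tuples \<open>i\<^sub>1 < \<dots> < i\<^sub>s\<close> in \<open>{1..k}\<close> are the subsets of \<open>{1..k}\<close> of cardinality \<open>s\<close>.\<close>

definition is_measure :: "('x::bounded_lattice \<Rightarrow> 'b::ab_group_add) \<Rightarrow> bool" where
  "is_measure \<nu> \<longleftrightarrow> \<nu> bot = 0 \<and>
    (\<forall>k\<ge>2. \<forall>x :: nat \<Rightarrow> 'x.
       \<nu> (Sup_fin (x ` {1..k})) =
       (\<Sum>s = 1..k. (uminus ^^ (s + 1)) (\<Sum>J | J \<subseteq> {1..k} \<and> card J = s. \<nu> (Inf_fin (x ` J)))))"

definition lattice_measures :: "('x::bounded_lattice \<Rightarrow> 'b::ab_group_add) set" where
  "lattice_measures = {\<nu>. is_measure \<nu>}"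

definition lattice_action :: "('g, 'z) monoid_scheme \<Rightarrow> ('g \<Rightarrow> 'x::lattice \<Rightarrow> 'x) \<Rightarrow> bool" where
  "lattice_action G act \<longleftrightarrow> group_action G UNIV act \<and>
    (\<forall>g\<in>carrier G. \<forall>x y. act g (inf x y) = inf (act g x) (act g y) \<and>
                          act g (sup x y) = sup (act g x) (act g y))"

definition invariant_measures ::
  "('g, 'z) monoid_scheme \<Rightarrow> ('g \<Rightarrow> 'x \<Rightarrow> 'x) \<Rightarrow> ('x::bounded_lattice \<Rightarrow> 'b::ab_group_add) set" where
  "invariant_measures G act = {\<nu> \<in> lattice_measures. \<forall>g\<in>carrier G. \<forall>x. \<nu> (act g x) = \<nu> x}"


section \<open>The rings \<open>\<int>[X]/I\<close> and \<open>A[X]/I\<^sub>A\<close>\<close>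

type_synonym ('x, 'a) lpoly = "('x \<Rightarrow>\<^sub>0 nat) \<Rightarrow>\<^sub>0 'a"

definition Const :: "'a \<Rightarrow> ('x, 'a::zero) lpoly" where
  "Const c = Poly_Mapping.single 0 c"

definition Var :: "'x \<Rightarrow> ('x, 'a::comm_unital_ring) lpoly" where
  "Var x = Poly_Mapping.single (Poly_Mapping.single x 1) 1"

definition lattice_relations :: "('x::bounded_lattice, int) lpoly set" where
  "lattice_relations =
     {Var bot, Var Orderings.top - 1}
     \<union> {Var (inf x y) - Var x * Var y | x y. True}
     \<union> {Var (sup x y) - Var x - Var y + Var x * Var y | x y. True}"

definition lattice_ideal :: "('x::bounded_lattice, int) lpoly set" where
  "lattice_ideal = is_ideal hull lattice_relations"

definition lattice_ideal_over :: "('x::bounded_lattice, 'a::comm_unital_ring) lpoly set" where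
  "lattice_ideal_over = is_ideal hull (Poly_Mapping.map int_embed ` lattice_ideal)"

lemma lattice_ideal_over_int: "lattice_ideal_over = (lattice_ideal :: ('x::bounded_lattice, int) lpoly set)"
proof -
  have "Poly_Mapping.map int_embed p = p" for p :: "('x, int) lpoly"
    by (rule poly_mapping_eqI) (simp add: Poly_Mapping.map.rep_eq int_embed_eq_of_int when_def)
  then show ?thesis
    by (simp add: lattice_ideal_over_def lattice_ideal_def)
qed

lemma is_ideal_lattice_ideal_over: "is_ideal lattice_ideal_over"
  unfolding lattice_ideal_over_def by (rule is_ideal_hull)

definition lattice_cong ::
  "('x::bounded_lattice, 'a::comm_unital_ring) lpoly \<Rightarrow> ('x, 'a) lpoly \<Rightarrow> bool" where
  "lattice_cong p q \<longleftrightarrow> p - q \<in> lattice_ideal_over"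

text \<open>
  \<open>('x, 'a) lattice_ring\<close> is \<open>A[X]/I\<^sub>A\<close>; by lemma \<open>lattice_ideal_over_int\<close>,
  \<open>('x, int) lattice_ring\<close> is \<open>\<int>[X]/I\<close>.
\<close>

quotient_type (overloaded) ('x, 'a) lattice_ring =
  "('x::bounded_lattice \<Rightarrow>\<^sub>0 nat) \<Rightarrow>\<^sub>0 'a::comm_unital_ring" / lattice_cong
proof (rule equivpI)
  note I = is_ideal_lattice_ideal_over
  show "reflp (lattice_cong :: ('x, 'a) lpoly \<Rightarrow> _)"
    by (auto simp: reflp_def lattice_cong_def is_ideal_zero[OF I])
  show "symp (lattice_cong :: ('x, 'a) lpoly \<Rightarrow> _)"
    unfolding symp_def lattice_cong_def using is_ideal_uminus[OF I] by (metis minus_diff_eq)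
  show "transp (lattice_cong :: ('x, 'a) lpoly \<Rightarrow> _)"
    unfolding transp_def lattice_cong_def
    using is_ideal_add[OF I, of "p - q" "q - r" for p q r] by fastforce
qed

lemma poly_mapping_sum_monomials:
  "(\<Sum>m\<in>Poly_Mapping.keys p. Poly_Mapping.single m (Poly_Mapping.lookup p m)) = p"
  by (rule poly_mapping_eqI)
    (auto simp: lookup_sum lookup_single when_def sum.delta in_keys_iff)

lemma Const_one_mult: "Const (1 :: 'a::comm_unital_ring) * p = p"
proof -
  have "Const 1 * p = (\<Sum>m\<in>Poly_Mapping.keys p. Const 1 * Poly_Mapping.single m (Poly_Mapping.lookup p m))"
    by (simp add: sum_distrib_left[symmetric] poly_mapping_sum_monomials)
  then show ?thesis
    by (simp add: Const_def mult_single poly_mapping_sum_monomials)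
qed

instantiation lattice_ring :: (bounded_lattice, comm_unital_ring) comm_unital_ring
begin

lift_definition zero_lattice_ring :: "('a, 'b) lattice_ring" is 0 .

lift_definition one_lattice_ring :: "('a, 'b) lattice_ring" is "Const 1" .

lift_definition plus_lattice_ring ::
  "('a, 'b) lattice_ring \<Rightarrow> ('a, 'b) lattice_ring \<Rightarrow> ('a, 'b) lattice_ring" is plus
  unfolding lattice_cong_def
  by (metis add_diff_add is_ideal_add[OF is_ideal_lattice_ideal_over])

lift_definition uminus_lattice_ring :: "('a, 'b) lattice_ring \<Rightarrow> ('a, 'b) lattice_ring" is uminus
  unfolding lattice_cong_def
  by (metis minus_diff_minus is_ideal_uminus[OF is_ideal_lattice_ideal_over])

lift_definition minus_lattice_ring ::
  "('a, 'b) lattice_ring \<Rightarrow> ('a, 'b) lattice_ring \<Rightarrow> ('a, 'b) lattice_ring" is minus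
proof -
  fix p p' q q' :: "('a, 'b) lpoly"
  assume "lattice_cong p p'" and "lattice_cong q q'"
  then have "(p - p') - (q - q') \<in> lattice_ideal_over"
    unfolding lattice_cong_def by (rule is_ideal_diff[OF is_ideal_lattice_ideal_over])
  then show "lattice_cong (p - q) (p' - q')"
    by (simp add: lattice_cong_def algebra_simps)
qed

lift_definition times_lattice_ring ::
  "('a, 'b) lattice_ring \<Rightarrow> ('a, 'b) lattice_ring \<Rightarrow> ('a, 'b) lattice_ring" is times
proof -
  fix p p' q q' :: "('a, 'b) lpoly"
  assume "lattice_cong p p'" and "lattice_cong q q'"
  then have "q * (p - p') + p' * (q - q') \<in> lattice_ideal_over"
    unfolding lattice_cong_def
    by (intro is_ideal_add is_ideal_mult is_ideal_lattice_ideal_over)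
  then show "lattice_cong (p * q) (p' * q')"
    by (simp add: lattice_cong_def algebra_simps)
qed

instance
proof
  fix p q r :: "('a, 'b) lattice_ring"
  have *: "lattice_cong a a" for a :: "('a, 'b) lpoly"
    by (simp add: lattice_cong_def is_ideal_zero[OF is_ideal_lattice_ideal_over])
  show "p + q + r = p + (q + r)" by transfer (simp add: * add.assoc)
  show "p + q = q + p" by transfer (simp add: * add.commute)
  show "0 + p = p" by transfer (simp add: *)
  show "- p + p = 0" by transfer (simp add: *)
  show "p - q = p + - q" by transfer (simp add: *)
  show "p * q * r = p * (q * r)" by transfer (simp add: * mult.assoc)
  show "p * q = q * p" by transfer (simp add: * mult.commute)
  show "1 * p = p" by transfer (simp add: * Const_one_mult)
  show "(p + q) * r = p * r + q * r" by transfer (simp add: * distrib_right)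
qed

end

lift_definition ring_scale ::
  "'a::comm_unital_ring \<Rightarrow> ('x::bounded_lattice, 'a) lattice_ring \<Rightarrow> ('x, 'a) lattice_ring"
  is "\<lambda>c p. Const c * p"
  unfolding lattice_cong_def
  by (metis right_diff_distrib is_ideal_mult[OF is_ideal_lattice_ideal_over])


section \<open>The induced action\<close>

text \<open>The substitution of \<open>f x\<close> for every variable \<open>x\<close>, first on monomials, then on polynomials.\<close>

definition rename_monom :: "('x \<Rightarrow> 'x) \<Rightarrow> ('x \<Rightarrow>\<^sub>0 nat) \<Rightarrow> ('x \<Rightarrow>\<^sub>0 nat)" where
  "rename_monom f m = (\<Sum>x\<in>Poly_Mapping.keys m. Poly_Mapping.single (f x) (Poly_Mapping.lookup m x))"

definition rename :: "('x \<Rightarrow> 'x) \<Rightarrow> ('x, 'a::comm_unital_ring) lpoly \<Rightarrow> ('x, 'a) lpoly" where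
  "rename f p =
    (\<Sum>m\<in>Poly_Mapping.keys p. Poly_Mapping.single (rename_monom f m) (Poly_Mapping.lookup p m))"

text \<open>
  The endomorphism of \<open>A[X]/I\<^sub>A\<close> induced by an endomorphism \<open>f\<close> of \<open>X\<close>. It is defined through
  representatives for arbitrary \<open>f\<close>; it does not depend on them if \<open>f\<close> preserves the lattice
  operations and the bounds (lemma \<open>induced_abs\<close>).
\<close>

definition induced ::
  "('x \<Rightarrow> 'x) \<Rightarrow> ('x::bounded_lattice, 'a::comm_unital_ring) lattice_ring \<Rightarrow> ('x, 'a) lattice_ring" where
  "induced f q = abs_lattice_ring (rename f (rep_lattice_ring q))"

lemma sum_keys_superset:
  assumes "finite S" "Poly_Mapping.keys m \<subseteq> S" "\<And>x. h x 0 = 0"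
  shows "(\<Sum>x\<in>Poly_Mapping.keys m. h x (Poly_Mapping.lookup m x)) = (\<Sum>x\<in>S. h x (Poly_Mapping.lookup m x))"
  by (rule sum.mono_neutral_left) (use assms in \<open>auto simp: in_keys_iff\<close>)

lemma sum_keys_add:
  assumes "\<And>x. h x 0 = (0 :: 'c::comm_monoid_add)" "\<And>x a b. h x (a + b) = h x a + h x b"
  shows "(\<Sum>x\<in>Poly_Mapping.keys (m + n). h x (Poly_Mapping.lookup (m + n) x)) =
    (\<Sum>x\<in>Poly_Mapping.keys m. h x (Poly_Mapping.lookup m x)) +
    (\<Sum>x\<in>Poly_Mapping.keys n. h x (Poly_Mapping.lookup n x))"
proof -
  let ?S = "Poly_Mapping.keys m \<union> Poly_Mapping.keys n"
  have "finite ?S" by simp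
  then show ?thesis
    using sum_keys_superset[of ?S "m + n" h] sum_keys_superset[of ?S m h]
      sum_keys_superset[of ?S n h] Poly_Mapping.keys_add[of m n] assms
    by (simp add: lookup_add sum.distrib)
qed

lemma rename_monom_add: "rename_monom f (m + n) = rename_monom f m + rename_monom f n"
  unfolding rename_monom_def by (rule sum_keys_add) (auto simp: single_add)

lemma rename_monom_zero [simp]: "rename_monom f 0 = 0"
  by (simp add: rename_monom_def)

lemma rename_monom_single [simp]: "rename_monom f (Poly_Mapping.single x n) = Poly_Mapping.single (f x) n"
  by (cases "n = 0") (auto simp: rename_monom_def)

lemma rename_add: "rename f (p + q) = rename f p + rename f q"
  unfolding rename_def by (rule sum_keys_add) (auto simp: single_add)

lemma rename_zero [simp]: "rename f 0 = 0"
  by (simp add: rename_def)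

lemma rename_single [simp]: "rename f (Poly_Mapping.single m c) = Poly_Mapping.single (rename_monom f m) c"
  by (cases "c = 0") (auto simp: rename_def)

lemma rename_diff: "rename f (p - q) = rename f p - rename f q"
  by (metis rename_add add_diff_cancel_right' diff_add_cancel)

lemma rename_sum: "rename f (sum h S) = (\<Sum>i\<in>S. rename f (h i))"
  by (induction S rule: infinite_finite_induct) (auto simp: rename_add)

lemma rename_mult: "rename f (p * q) = rename f p * rename f q"
proof -
  have "p * q = (\<Sum>m\<in>Poly_Mapping.keys p. \<Sum>n\<in>Poly_Mapping.keys q.
      Poly_Mapping.single m (Poly_Mapping.lookup p m) * Poly_Mapping.single n (Poly_Mapping.lookup q n))"
    by (simp add: sum_product[symmetric] poly_mapping_sum_monomials)
  then have "rename f (p * q) = (\<Sum>m\<in>Poly_Mapping.keys p. \<Sum>n\<in>Poly_Mapping.keys q.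
      rename f (Poly_Mapping.single m (Poly_Mapping.lookup p m)) *
      rename f (Poly_Mapping.single n (Poly_Mapping.lookup q n)))"
    by (simp add: rename_sum mult_single rename_monom_add)
  also have "\<dots> = rename f p * rename f q"
    by (simp add: rename_def[of f p] rename_def[of f q] sum_product)
  finally show ?thesis .
qed

lemma int_embed_zero [simp]: "int_embed 0 = 0"
  by (simp add: int_embed_def)

lemma int_embed_diff_nat:
  "int_embed (int m - int n) = (\<Sum>i<m. 1) - (\<Sum>i<n. 1 :: 'a::comm_unital_ring)"
proof -
  have *: "(\<Sum>i<a + b. 1) = (\<Sum>i<a. 1) + (\<Sum>i<b. 1 :: 'a)" for a b :: nat
    by (induction b) (auto simp: add.assoc)
  show ?thesis
  proof (cases "n \<le> m")
    case True
    then obtain d where "m = n + d" using le_Suc_ex by blast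
    then show ?thesis by (simp add: int_embed_def *)
  next
    case False
    then obtain d where "n = m + d" by (metis le_Suc_ex nat_le_linear)
    then show ?thesis by (simp add: int_embed_def *)
  qed
qed

lemma int_embed_add: "int_embed (a + b) = int_embed a + (int_embed b :: 'a::comm_unital_ring)"
proof -
  have *: "(\<Sum>i<k + l. 1) = (\<Sum>i<k. 1) + (\<Sum>i<l. 1 :: 'a)" for k l :: nat
    by (induction l) (auto simp: add.assoc)
  obtain m n where a: "a = int m - int n" by (metis int_diff_cases)
  obtain m' n' where b: "b = int m' - int n'" by (metis int_diff_cases)
  have "a + b = int (m + m') - int (n + n')" by (simp add: a b)
  then have "int_embed (a + b) = (\<Sum>i<m + m'. 1) - (\<Sum>i<n + n'. 1 :: 'a)"
    by (metis int_embed_diff_nat)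
  then show ?thesis by (simp add: a b int_embed_diff_nat *)
qed

lemma map_int_embed_add:
  "Poly_Mapping.map int_embed (p + q) =
    Poly_Mapping.map int_embed p + (Poly_Mapping.map int_embed q :: ('x, 'a::comm_unital_ring) lpoly)"
  by (rule poly_mapping_eqI)
    (auto simp: Poly_Mapping.map.rep_eq lookup_add when_def int_embed_add[symmetric])

lemma map_int_embed_zero [simp]: "Poly_Mapping.map int_embed 0 = 0"
  by (rule poly_mapping_eqI) (simp add: Poly_Mapping.map.rep_eq)

lemma map_int_embed_sum:
  "Poly_Mapping.map int_embed (sum h S) =
    (\<Sum>i\<in>S. Poly_Mapping.map int_embed (h i) :: ('x, 'a::comm_unital_ring) lpoly)"
  by (induction S rule: infinite_finite_induct) (auto simp: map_int_embed_add)

lemma map_int_embed_rename: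
  "rename f (Poly_Mapping.map int_embed p) =
    (Poly_Mapping.map int_embed (rename f p) :: ('x, 'a::comm_unital_ring) lpoly)"
proof -
  have "rename f (Poly_Mapping.map int_embed p) =
      rename f (Poly_Mapping.map int_embed
        (\<Sum>m\<in>Poly_Mapping.keys p. Poly_Mapping.single m (Poly_Mapping.lookup p m)))"
    by (simp only: poly_mapping_sum_monomials)
  also have "\<dots> = Poly_Mapping.map int_embed (rename f p)"
    by (simp add: map_int_embed_sum rename_sum rename_def[of f p] map_single)
  finally show ?thesis .
qed

lemma rename_Var [simp]: "rename f (Var x) = Var (f x)"
  by (simp add: Var_def)

lemma rename_one [simp]: "rename f (1 :: ('x, int) lpoly) = 1"
  by (metis rename_single rename_monom_zero single_one)

lemma is_ideal_preimage_rename: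
  assumes "is_ideal J" shows "is_ideal {p. rename f p \<in> J}"
  using assms by (simp add: is_ideal_def rename_diff rename_mult)

context
  fixes f :: "'x::bounded_lattice \<Rightarrow> 'x"
  assumes f_bot: "f bot = bot" and f_top: "f Orderings.top = Orderings.top"
    and f_inf: "\<And>x y. f (inf x y) = inf (f x) (f y)"
    and f_sup: "\<And>x y. f (sup x y) = sup (f x) (f y)"
begin

lemma rename_lattice_ideal:
  assumes "p \<in> lattice_ideal" shows "rename f p \<in> lattice_ideal"
proof -
  have "lattice_ideal \<subseteq> {p. rename f p \<in> lattice_ideal}"
    unfolding lattice_ideal_def
  proof (rule hull_minimal)
    have "rename f p \<in> lattice_relations" if p: "p \<in> lattice_relations" for p
    proof -
      consider "p = Var bot" | "p = Var Orderings.top - 1"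
        | x y where "p = Var (inf x y) - Var x * Var y"
        | x y where "p = Var (sup x y) - Var x - Var y + Var x * Var y"
        using p unfolding lattice_relations_def by blast
      then show ?thesis
      proof cases
        case 1
        then show ?thesis by (simp add: f_bot lattice_relations_def)
      next
        case 2
        then show ?thesis by (simp add: rename_diff f_top lattice_relations_def)
      next
        case (3 x y)
        then have "rename f p = Var (inf (f x) (f y)) - Var (f x) * Var (f y)"
          by (simp add: rename_diff rename_mult f_inf)
        then show ?thesis unfolding lattice_relations_def by blast
      next
        case (4 x y)
        then have "rename f p = Var (sup (f x) (f y)) - Var (f x) - Var (f y) + Var (f x) * Var (f y)"
          by (simp add: rename_diff rename_add rename_mult f_sup)
        then show ?thesis unfolding lattice_relations_def by blast
      qed
    qed
    then show "lattice_relations \<subseteq> {p. rename f p \<in> is_ideal hull lattice_relations}"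
      by (auto intro: hull_inc)
  qed (rule is_ideal_preimage_rename[OF is_ideal_hull])
  with assms show ?thesis by auto
qed

lemma rename_lattice_ideal_over:
  assumes "p \<in> (lattice_ideal_over :: ('x, 'a::comm_unital_ring) lpoly set)"
  shows "rename f p \<in> lattice_ideal_over"
proof -
  have "(lattice_ideal_over :: ('x, 'a) lpoly set) \<subseteq> {p. rename f p \<in> lattice_ideal_over}"
    unfolding lattice_ideal_over_def
    by (rule hull_minimal)
      (auto simp: map_int_embed_rename intro!: hull_inc rename_lattice_ideal
        is_ideal_preimage_rename is_ideal_hull)
  with assms show ?thesis by auto
qed

lemma induced_abs:
  "induced f (abs_lattice_ring p) =
    (abs_lattice_ring (rename f p) :: ('x, 'a::comm_unital_ring) lattice_ring)"
proof -
  have "lattice_cong (rep_lattice_ring (abs_lattice_ring p)) p"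
    by (rule Quotient3_rep_abs[OF Quotient3_lattice_ring])
      (simp add: lattice_cong_def is_ideal_zero[OF is_ideal_lattice_ideal_over])
  then show ?thesis
    unfolding induced_def lattice_ring.abs_eq_iff lattice_cong_def
    by (metis rename_diff rename_lattice_ideal_over)
qed

end


section \<open>The modules of homomorphisms\<close>

definition Hom_int :: "(('x::bounded_lattice, int) lattice_ring \<Rightarrow> 'b::ab_group_add) set" where
  "Hom_int = {\<phi>. additive \<phi>}"

definition Hom_over ::
  "('a \<Rightarrow> 'b \<Rightarrow> 'b) \<Rightarrow> (('x::bounded_lattice, 'a::comm_unital_ring) lattice_ring \<Rightarrow> 'b::ab_group_add) set" where
  "Hom_over scale = {\<phi>. additive \<phi> \<and> (\<forall>a m. \<phi> (ring_scale a m) = scale a (\<phi> m))}"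

text \<open>\<open>(g \<phi>)(m) = g \<phi>(g\<^sup>-\<^sup>1 m) = \<phi>(g\<^sup>-\<^sup>1 m)\<close>, the action on the values being trivial.\<close>

definition hom_act ::
  "('g, 'z) monoid_scheme \<Rightarrow> ('g \<Rightarrow> 'x \<Rightarrow> 'x) \<Rightarrow> 'g \<Rightarrow>
   (('x::bounded_lattice, 'a::comm_unital_ring) lattice_ring \<Rightarrow> 'b) \<Rightarrow> ('x, 'a) lattice_ring \<Rightarrow> 'b" where
  "hom_act G act g \<phi> = (\<lambda>m. \<phi> (induced (act (inv\<^bsub>G\<^esub> g)) m))"

definition fixed_homs ::
  "('g, 'z) monoid_scheme \<Rightarrow> ('g \<Rightarrow> 'x \<Rightarrow> 'x) \<Rightarrow>
   (('x::bounded_lattice, 'a::comm_unital_ring) lattice_ring \<Rightarrow> 'b) set \<Rightarrow>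
   (('x, 'a) lattice_ring \<Rightarrow> 'b) set" where
  "fixed_homs G act H = {\<phi> \<in> H. \<forall>g\<in>carrier G. hom_act G act g \<phi> = \<phi>}"

end

theory Submission
  imports Defs
begin

text \<open>
  A function \<open>\<nu>\<close> is a measure iff \<open>\<nu>(0) = 0\<close> and
  \<open>\<nu>(z \<sqinter> (x \<squnion> y)) = \<nu>(z \<sqinter> x) + \<nu>(z \<sqinter> y) - \<nu>(z \<sqinter> x \<sqinter> y)\<close> for all \<open>x, y, z\<close>. Modulo \<open>I\<^sub>A\<close>
  every monomial is congruent to the meet of its variables, so an \<open>A\<close>-linear form on \<open>A[X]/I\<^sub>A\<close> is
  determined by its values on the classes of the variables, and these values form a measure.
  Conversely, given a measure \<open>\<nu>\<close>, the linear form on \<open>A[X]\<close> that sends a monomial to the value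
  of \<open>\<nu>\<close> at the meet of its variables kills every monomial multiple of every lattice relation;
  for the relation of \<open>x \<squnion> y\<close> this is the identity above. Hence restriction to the variables is
  an isomorphism. It is equivariant, and for \<open>A = \<int>\<close> linearity is mere additivity.
\<close>

section \<open>Inclusion-exclusion\<close>

text \<open>For z = top and S = {1..k} this is the right-hand side in the definition of a measure;
  the additional meet with z makes an induction on S possible. The empty set is left out because
  \<open>Inf_fin\<close> has no meaningful value there, and signs are iterates of
  \<open>uminus\<close> because the values lie in a mere abelian group.\<close>

definition inclusion_exclusion ::
  "('x::bounded_lattice \<Rightarrow> 'b::ab_group_add) \<Rightarrow> ('i \<Rightarrow> 'x) \<Rightarrow> 'x \<Rightarrow> 'i set \<Rightarrow> 'b" where
  "inclusion_exclusion \<nu> x z S =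
    (\<Sum>J\<in>Pow S - {{}}. (uminus ^^ Suc (card J)) (\<nu> (inf z (Inf_fin (x ` J)))))"

lemma funpow_uminus_zero: "(uminus ^^ n) (0 :: 'b::ab_group_add) = 0"
  by (induction n) auto

lemma funpow_uminus_add: "(uminus ^^ n) (a + b :: 'b::ab_group_add) = (uminus ^^ n) a + (uminus ^^ n) b"
  by (induction n) auto

lemma funpow_uminus_sum: "(uminus ^^ n) (sum h S :: 'b::ab_group_add) = (\<Sum>i\<in>S. (uminus ^^ n) (h i))"
  by (induction S rule: infinite_finite_induct) (auto simp: funpow_uminus_zero funpow_uminus_add)

lemma inclusion_exclusion_empty [simp]: "inclusion_exclusion \<nu> x z {} = 0"
  by (simp add: inclusion_exclusion_def)

text \<open>A nonempty subset of \<open>insert i S\<close> is {i}, a nonempty subset J of S, or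
  \<open>insert i J\<close> for such a J. In the last case the element x i is absorbed into z, and
  the larger cardinality flips the sign.\<close>

lemma inclusion_exclusion_insert:
  assumes "finite S" "i \<notin> S"
  shows "inclusion_exclusion \<nu> x z (insert i S) =
    \<nu> (inf z (x i)) + inclusion_exclusion \<nu> x z S - inclusion_exclusion \<nu> x (inf z (x i)) S"
proof -
  let ?t = "\<lambda>z J. (uminus ^^ Suc (card J)) (\<nu> (inf z (Inf_fin (x ` J))))"
  let ?P = "Pow S - {{}}"
  have fin: "finite ?P" using assms by simp
  have split: "Pow (insert i S) - {{}} = insert {i} (?P \<union> insert i ` ?P)"
    by (auto simp: Pow_insert)
  have inj: "inj_on (insert i) ?P"
    using assms by (auto simp: inj_on_def)
  have step: "?t z (insert i J) = - ?t (inf z (x i)) J" if "J \<in> ?P" for J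
  proof -
    have J: "finite J" "J \<noteq> {}" "i \<notin> J" using that assms finite_subset by auto
    then have "Inf_fin (x ` insert i J) = inf (x i) (Inf_fin (x ` J))"
      by (simp add: Inf_fin.insert)
    with J show ?thesis by (simp add: inf.assoc)
  qed
  have "inclusion_exclusion \<nu> x z (insert i S) = ?t z {i} + (\<Sum>J\<in>?P \<union> insert i ` ?P. ?t z J)"
    unfolding inclusion_exclusion_def split
    by (rule sum.insert) (use fin assms in auto)
  also have "(\<Sum>J\<in>?P \<union> insert i ` ?P. ?t z J) = sum (?t z) ?P + sum (?t z) (insert i ` ?P)"
    by (rule sum.union_disjoint) (use fin assms in auto)
  also have "sum (?t z) (insert i ` ?P) = (\<Sum>J\<in>?P. ?t z (insert i J))"
    by (simp only: sum.reindex[OF inj] o_def)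
  also have "\<dots> = (\<Sum>J\<in>?P. - ?t (inf z (x i)) J)"
    by (rule sum.cong[OF refl step])
  also have "?t z {i} = \<nu> (inf z (x i))" by simp
  finally show ?thesis
    by (simp only: inclusion_exclusion_def sum_negf) simp
qed

text \<open>The double sum over s and over index sets of cardinality s is the sum over all nonempty
  index sets, grouped by cardinality.\<close>

lemma is_measure_inclusion_exclusion:
  "is_measure \<nu> \<longleftrightarrow> \<nu> bot = 0 \<and>
    (\<forall>k\<ge>2. \<forall>x :: nat \<Rightarrow> 'x::bounded_lattice.
      \<nu> (Sup_fin (x ` {1..k})) = inclusion_exclusion \<nu> x Orderings.top {1..k})"
proof -
  have "(\<Sum>s = 1..k. (uminus ^^ (s + 1)) (\<Sum>J | J \<subseteq> {1..k} \<and> card J = s. \<nu> (Inf_fin (x ` J)))) =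
      inclusion_exclusion \<nu> x Orderings.top {1..k}" for k and x :: "nat \<Rightarrow> 'x"
  proof -
    let ?P = "Pow {1..k} - {{}}"
    have card: "card ` ?P \<subseteq> {1..k}"
    proof
      fix s assume "s \<in> card ` ?P"
      then obtain J where J: "J \<subseteq> {1..k}" "J \<noteq> {}" "s = card J" by auto
      then have "finite J" using finite_subset by blast
      with J show "s \<in> {1..k}"
        using card_mono[of "{1..k}" J] by (auto simp: Suc_le_eq card_gt_0_iff)
    qed
    have "inclusion_exclusion \<nu> x Orderings.top {1..k} =
        (\<Sum>s = 1..k. \<Sum>J | J \<in> ?P \<and> card J = s. (uminus ^^ Suc (card J)) (\<nu> (Inf_fin (x ` J))))"
      unfolding inclusion_exclusion_def inf_top_left
      by (rule sum.group[symmetric]) (use card in auto)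
    also have "\<dots> = (\<Sum>s = 1..k. (uminus ^^ (s + 1)) (\<Sum>J | J \<subseteq> {1..k} \<and> card J = s. \<nu> (Inf_fin (x ` J))))"
      unfolding funpow_uminus_sum
      by (intro sum.cong) auto
    finally show ?thesis by simp
  qed
  then show ?thesis by (simp add: is_measure_def)
qed

text \<open>As \<open>X\<close> need not be distributive, the formula below \<open>z\<close> does not follow from the case \<open>k = 2\<close>
  alone; it comes from reading \<open>z \<squnion> x \<squnion> y\<close> as a join of two and as a join of three elements.\<close>

lemma is_measure_iff:
  "is_measure \<nu> \<longleftrightarrow> \<nu> bot = 0 \<and>
    (\<forall>z x y. \<nu> (inf z (sup x y)) = \<nu> (inf z x) + \<nu> (inf z y) - \<nu> (inf z (inf x y)))"
  (is "_ \<longleftrightarrow> _ \<and> ?M")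
proof -
  have "?M" if m: "is_measure \<nu>"
  proof -
    have ie: "\<nu> (Sup_fin (x ` {1..k})) = inclusion_exclusion \<nu> x Orderings.top {1..k}"
      if "k \<ge> 2" for k and x :: "nat \<Rightarrow> 'a"
      using m that unfolding is_measure_inclusion_exclusion by blast
    have two: "\<nu> (sup x y) = \<nu> x + \<nu> y - \<nu> (inf x y)" for x y
    proof -
      have "{1..2} = {1, 2::nat}" by auto
      then show ?thesis
        using ie[of 2 "\<lambda>i. if i = 1 then x else y"]
        by (simp add: inclusion_exclusion_insert sup.commute)
    qed
    have three: "\<nu> (sup z (sup x y)) = \<nu> z + \<nu> x + \<nu> y - \<nu> (inf x y) - \<nu> (inf z x) - \<nu> (inf z y)
        + \<nu> (inf z (inf x y))" for x y z
    proof -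
      have "{1..3} = {1, 2, 3::nat}" by auto
      then show ?thesis
        using ie[of 3 "\<lambda>i. if i = 1 then z else if i = 2 then x else y"]
        by (simp add: inclusion_exclusion_insert inf.assoc sup.commute sup.left_commute diff_diff_eq2
            add_diff_eq diff_add_eq diff_diff_add[symmetric])
    qed
    show ?M
    proof (intro allI)
      fix z x y
      have "\<nu> (inf z (sup x y)) = \<nu> z + \<nu> (sup x y) - \<nu> (sup z (sup x y))"
        using two[of z "sup x y"] by simp
      then show "\<nu> (inf z (sup x y)) = \<nu> (inf z x) + \<nu> (inf z y) - \<nu> (inf z (inf x y))"
        unfolding three two[of x y] by (simp add: algebra_simps)
    qed
  qed
  moreover have "is_measure \<nu>" if bot: "\<nu> bot = 0" and M: ?M
  proof -
    \<comment> \<open>The element z must vary in the induction: inserting i uses the hypothesis both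
      for z and for \<open>inf z (x i)\<close>. The case z = top gives the measure property.\<close>
    have "\<nu> (inf z (Sup_fin (x ` S))) = inclusion_exclusion \<nu> x z S"
      if "finite S" "S \<noteq> {}" for x :: "nat \<Rightarrow> 'a" and z S
      using that
    proof (induction S arbitrary: z rule: finite_ne_induct)
      case (singleton i)
      then show ?case by (simp add: inclusion_exclusion_insert)
    next
      case (insert i S)
      then have "Sup_fin (x ` insert i S) = sup (x i) (Sup_fin (x ` S))"
        by (simp add: Sup_fin.insert)
      then show ?case
        using insert M by (simp add: inclusion_exclusion_insert flip: inf.assoc)
    qed
    from this[of "{1..k}" Orderings.top for k] show ?thesis
      by (simp add: is_measure_inclusion_exclusion bot)
  qed
  ultimately show ?thesis
    by (auto simp: is_measure_def)
qed

section \<open>Modules\<close>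

context unital_module
begin

lemma scale_zero_right [simp]: "scale a 0 = 0"
  using scale_right_distrib[of a 0 0] by simp

lemma scale_zero_left [simp]: "scale 0 x = 0"
  using scale_left_distrib[of 0 0 x] by simp

lemma scale_diff_right: "scale a (x - y) = scale a x - scale a y"
  using scale_right_distrib[of a "x - y" y] by simp

lemma unital_module_pointwise: "unital_module (pointwise scale :: 'a \<Rightarrow> ('c \<Rightarrow> 'b) \<Rightarrow> 'c \<Rightarrow> 'b)"
  by unfold_locales
    (simp_all add: pointwise_def fun_eq_iff scale_right_distrib scale_left_distrib scale_scale scale_one)

lemma submodule_lattice_measures:
  "is_submodule (pointwise scale) (lattice_measures :: ('x::bounded_lattice \<Rightarrow> 'b) set)"
  unfolding is_submodule_def
proof (intro conjI ballI allI)
  fix a and \<nu> \<nu>' :: "'x \<Rightarrow> 'b" assume "\<nu> \<in> lattice_measures" and "\<nu>' \<in> lattice_measures"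
  then show "\<nu> + \<nu>' \<in> lattice_measures" and "pointwise scale a \<nu> \<in> lattice_measures"
    by (simp_all add: lattice_measures_def is_measure_iff pointwise_def scale_right_distrib scale_diff_right)
qed (simp_all add: unital_module_pointwise lattice_measures_def is_measure_iff)

lemma submodule_Hom_int:
  "is_submodule (pointwise scale) (Hom_int :: (('x::bounded_lattice, int) lattice_ring \<Rightarrow> 'b) set)"
  by (auto simp: is_submodule_def unital_module_pointwise Hom_int_def additive_def
      pointwise_def scale_right_distrib algebra_simps)

lemma submodule_Hom_over:
  "is_submodule (pointwise scale) (Hom_over scale :: (('x::bounded_lattice, 'a) lattice_ring \<Rightarrow> 'b) set)"
  by (auto simp: is_submodule_def unital_module_pointwise Hom_over_def additive_def
      pointwise_def scale_right_distrib scale_scale mult.commute algebra_simps)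

lemma submodule_invariant_measures:
  "is_submodule (pointwise scale) (invariant_measures G act :: ('x::bounded_lattice \<Rightarrow> 'b) set)"
  using submodule_lattice_measures
  by (auto simp: is_submodule_def invariant_measures_def pointwise_def)

text \<open>The action is precomposition with a map of the ring, and this commutes with pointwise
  addition and scaling.\<close>

lemma submodule_fixed_homs:
  assumes "is_submodule (pointwise scale) H"
  shows "is_submodule (pointwise scale) (fixed_homs G act H)"
  using assms
  by (auto simp: is_submodule_def fixed_homs_def hom_act_def pointwise_def fun_eq_iff)

end

section \<open>Symmetry and transitivity of module isomorphism\<close>

lemma module_isomorphic_sym:
  assumes "module_isomorphic s S t T" shows "module_isomorphic t T s S"
proof -
  from assms obtain f where S: "is_submodule s S" and T: "is_submodule t T" and f: "bij_betw f S T"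
    and add: "\<And>x y. x \<in> S \<Longrightarrow> y \<in> S \<Longrightarrow> f (x + y) = f x + f y"
    and sc: "\<And>a x. x \<in> S \<Longrightarrow> f (s a x) = t a (f x)"
    unfolding module_isomorphic_def by blast
  let ?g = "inv_into S f"
  have g: "bij_betw ?g T S" by (rule bij_betw_inv_into[OF f])
  have gS: "?g u \<in> S" and fg: "f (?g u) = u" if "u \<in> T" for u
    using that g f by (auto simp: bij_betw_apply bij_betw_inv_into_right)
  have gf: "?g (f x) = x" if "x \<in> S" for x
    using that f by (simp add: bij_betw_inv_into_left)
  \<comment> \<open>Since S is a submodule, \<open>?g u + ?g v\<close> lies in S; f sends it to u +
    v, so it is the preimage of u + v.\<close>
  have "?g (u + v) = ?g u + ?g v" if "u \<in> T" "v \<in> T" for u v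
    using gf[of "?g u + ?g v"] gS[OF that(1)] gS[OF that(2)] S that
    by (simp add: add fg is_submodule_def)
  moreover have "?g (t a u) = s a (?g u)" if "u \<in> T" for a u
    using gf[of "s a (?g u)"] gS[OF that] S that by (simp add: sc fg is_submodule_def)
  ultimately show ?thesis
    unfolding module_isomorphic_def using S T g by blast
qed

lemma module_isomorphic_trans:
  assumes "module_isomorphic r R s S" "module_isomorphic s S t T"
  shows "module_isomorphic r R t T"
proof -
  from assms(1) obtain f where f: "bij_betw f R S"
    "\<And>x y. x \<in> R \<Longrightarrow> y \<in> R \<Longrightarrow> f (x + y) = f x + f y" "\<And>a x. x \<in> R \<Longrightarrow> f (r a x) = s a (f x)"
    unfolding module_isomorphic_def by blast
  from assms(2) obtain g where g: "bij_betw g S T"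
    "\<And>x y. x \<in> S \<Longrightarrow> y \<in> S \<Longrightarrow> g (x + y) = g x + g y" "\<And>a x. x \<in> S \<Longrightarrow> g (s a x) = t a (g x)"
    unfolding module_isomorphic_def by blast
  have "f x \<in> S" if "x \<in> R" for x using f(1) that by (rule bij_betw_apply)
  then show ?thesis
    using assms bij_betw_trans[OF f(1) g(1)] unfolding module_isomorphic_def
    by (intro conjI exI[of _ "g \<circ> f"]) (auto simp: f g)
qed

section \<open>The canonical structure of a module over the integers on an abelian group\<close>

definition int_scale :: "int \<Rightarrow> 'b::ab_group_add \<Rightarrow> 'b" where
  "int_scale n b = (\<Sum>i<nat n. b) - (\<Sum>i<nat (- n). b)"

lemma sum_const_add: "(\<Sum>i<k + l. b) = (\<Sum>i<k. b) + (\<Sum>i<l. b :: 'b::comm_monoid_add)" for k l :: nat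
  by (induction l) (auto simp: add.assoc)

text \<open>The value depends only on the difference of the two counts. Writing integers as
  differences of naturals thus avoids a case distinction on signs.\<close>

lemma int_scale_diff_nat: "int_scale (int m - int n) b = (\<Sum>i<m. b) - (\<Sum>i<n. b)"
proof (cases "n \<le> m")
  case True
  then obtain d where "m = n + d" using le_Suc_ex by blast
  then show ?thesis by (simp add: int_scale_def sum_const_add)
next
  case False
  then obtain d where "n = m + d" by (metis le_Suc_ex nat_le_linear)
  then show ?thesis by (simp add: int_scale_def sum_const_add)
qed

lemma int_scale_one: "int_scale 1 b = b"
  by (simp add: int_scale_def)

lemma int_scale_add_left: "int_scale (a + b) x = int_scale a x + int_scale b x"
proof -
  obtain m n where a: "a = int m - int n" by (metis int_diff_cases)
  obtain m' n' where b: "b = int m' - int n'" by (metis int_diff_cases)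
  have "a + b = int (m + m') - int (n + n')" by (simp add: a b)
  then have "int_scale (a + b) x = (\<Sum>i<m + m'. x) - (\<Sum>i<n + n'. x)"
    by (metis int_scale_diff_nat)
  then show ?thesis by (simp add: a b int_scale_diff_nat sum_const_add)
qed

lemma int_scale_diff_left: "int_scale (a - b) x = int_scale a x - int_scale b x"
  using int_scale_add_left[of "a - b" b x] by simp

lemma unital_module_int_scale: "unital_module (int_scale :: int \<Rightarrow> 'b::ab_group_add \<Rightarrow> 'b)"
proof
  fix a b :: int and x y :: 'b
  show "int_scale a (x + y) = int_scale a x + int_scale a y"
    by (simp add: int_scale_def sum.distrib)
  show "int_scale (a + b) x = int_scale a x + int_scale b x"
    by (rule int_scale_add_left)
  show "int_scale 1 x = x"
    by (rule int_scale_one)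
  have zero: "int_scale 0 u = 0" for u :: 'b
    by (simp add: int_scale_def)
  show "int_scale a (int_scale b x) = int_scale (a * b) x"
    by (induction a rule: int_induct[where k = 0])
      (simp_all add: zero int_scale_one int_scale_add_left int_scale_diff_left distrib_right left_diff_distrib)
qed

text \<open>Both sides vanish at a = 0 and change by \<phi>(x) when a changes by 1, so induction in
  both directions from 0 applies.\<close>

lemma additive_int_scale:
  assumes "unital_module s" "additive \<phi>" shows "\<phi> (s a x) = int_scale a (\<phi> x)"
proof -
  interpret unital_module s by fact
  interpret additive \<phi> by fact
  have "s (a - 1) x = s a x - x" for a
    using scale_left_distrib[of "a - 1" 1 x] by (simp add: scale_one)
  then show ?thesis
    by (induction a rule: int_induct[where k = 0])
      (simp_all add: zero add diff scale_left_distrib scale_one int_scale_one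
        int_scale_add_left int_scale_diff_left, simp add: int_scale_def)
qed

section \<open>Linear forms on the lattice ring\<close>

lemma abs_lattice_ring_eq_iff:
  "abs_lattice_ring p = abs_lattice_ring q \<longleftrightarrow> p - q \<in> lattice_ideal_over"
  by (simp add: lattice_ring.abs_eq_iff lattice_cong_def)

lemma Const_mult_single: "Const c * Poly_Mapping.single m d = Poly_Mapping.single m (c * d)"
  by (simp add: Const_def mult_single)

lemma unital_module_ring_scale:
  "unital_module (ring_scale :: 'a::comm_unital_ring \<Rightarrow> ('x::bounded_lattice, 'a) lattice_ring \<Rightarrow> _)"
proof
  have *: "lattice_cong p p" for p :: "('x, 'a) lpoly"
    by (simp add: lattice_cong_def is_ideal_zero[OF is_ideal_lattice_ideal_over])
  fix a b :: 'a and x y :: "('x, 'a) lattice_ring"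
  show "ring_scale a (x + y) = ring_scale a x + ring_scale a y"
    by transfer (simp add: * distrib_left)
  show "ring_scale (a + b) x = ring_scale a x + ring_scale b x"
    by transfer (simp add: * Const_def single_add distrib_right)
  show "ring_scale a (ring_scale b x) = ring_scale (a * b) x"
    by transfer (simp add: * Const_def mult_single flip: mult.assoc)
  show "ring_scale 1 x = x"
    by transfer (simp add: * Const_one_mult)
qed

text \<open>Additive maps are automatically linear over the integers. Hence the results below on
  linear forms over a general ring of scalars also cover \<open>Hom_int\<close>.\<close>

lemma Hom_int_eq_Hom_over: "Hom_int = Hom_over int_scale"
  unfolding Hom_int_def Hom_over_def
  using additive_int_scale[OF unital_module_ring_scale] by blast

section \<open>Change of coefficients from the integers to A\<close>

lemma int_embed_one [simp]: "int_embed 1 = 1"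
  by (simp add: int_embed_def)

lemma int_embed_mult: "int_embed (a * b) = int_embed a * (int_embed b :: 'a::comm_unital_ring)"
proof -
  have diff: "int_embed (a - b) = int_embed a - (int_embed b :: 'a)" for a b
    by (metis add_diff_cancel_right' diff_add_cancel int_embed_add)
  show ?thesis
    by (induction a rule: int_induct[where k = 0])
      (simp_all add: diff int_embed_add distrib_right left_diff_distrib)
qed

lemma map_int_embed_diff:
  "Poly_Mapping.map int_embed (p - q) =
    Poly_Mapping.map int_embed p - (Poly_Mapping.map int_embed q :: ('x, 'a::comm_unital_ring) lpoly)"
  using map_int_embed_add[of "p - q" q, where ?'a = 'a] by simp

text \<open>Expanding both factors into monomials reduces the claim to products of two monomials,
  where it is \<open>int_embed_mult\<close> on the coefficients.\<close>

lemma map_int_embed_mult: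
  "Poly_Mapping.map int_embed (p * q) =
    Poly_Mapping.map int_embed p * (Poly_Mapping.map int_embed q :: ('x, 'a::comm_unital_ring) lpoly)"
proof -
  let ?e = "Poly_Mapping.map int_embed :: ('x, int) lpoly \<Rightarrow> ('x, 'a) lpoly"
  let ?s = "\<lambda>p m. Poly_Mapping.single m (Poly_Mapping.lookup p m)"
  have "?e (p * q) = ?e ((\<Sum>m\<in>Poly_Mapping.keys p. ?s p m) * (\<Sum>n\<in>Poly_Mapping.keys q. ?s q n))"
    by (simp only: poly_mapping_sum_monomials)
  also have "\<dots> = ?e (\<Sum>m\<in>Poly_Mapping.keys p. ?s p m) * ?e (\<Sum>n\<in>Poly_Mapping.keys q. ?s q n)"
    by (simp add: sum_product map_int_embed_sum mult_single int_embed_mult)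
  finally show ?thesis by (simp only: poly_mapping_sum_monomials)
qed

lemma map_int_embed_Var [simp]: "Poly_Mapping.map int_embed (Var x) = Var x"
  by (simp add: Var_def)

text \<open>\<open>Const 1\<close> is the unit of A[X] in the form in which it represents the unit
  of the quotient ring.\<close>

lemma map_int_embed_one [simp]: "Poly_Mapping.map int_embed 1 = Const 1"
proof -
  have "Poly_Mapping.map int_embed (Poly_Mapping.single 0 1) = Const 1"
    by (subst map_single) (simp_all add: Const_def)
  then show ?thesis by simp
qed

lemma lattice_relation_over:
  "p \<in> lattice_relations \<Longrightarrow> Poly_Mapping.map int_embed p \<in> lattice_ideal_over"
  unfolding lattice_ideal_over_def lattice_ideal_def by (intro hull_inc imageI)

section \<open>Classes of variables and monomials in the quotient ring\<close>

definition var_class :: "'x::bounded_lattice \<Rightarrow> ('x, 'a::comm_unital_ring) lattice_ring" where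
  "var_class x = abs_lattice_ring (Var x)"

lemma var_class_bot: "var_class (bot :: 'x::bounded_lattice) = 0"
proof -
  have "Var bot \<in> (lattice_relations :: ('x, int) lpoly set)"
    by (simp add: lattice_relations_def)
  from lattice_relation_over[OF this] show ?thesis
    by (simp add: var_class_def zero_lattice_ring_def abs_lattice_ring_eq_iff)
qed

lemma var_class_top: "var_class (Orderings.top :: 'x::bounded_lattice) = 1"
proof -
  have "Var Orderings.top - 1 \<in> (lattice_relations :: ('x, int) lpoly set)"
    by (simp add: lattice_relations_def)
  from lattice_relation_over[OF this] show ?thesis
    by (simp add: var_class_def one_lattice_ring_def abs_lattice_ring_eq_iff map_int_embed_diff)
qed

lemma var_class_inf: "var_class (inf x y :: 'x::bounded_lattice) = var_class x * var_class y"
proof -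
  have "Var (inf x y) - Var x * Var y \<in> (lattice_relations :: ('x, int) lpoly set)"
    unfolding lattice_relations_def by blast
  from lattice_relation_over[OF this] show ?thesis
    by (simp add: var_class_def times_lattice_ring.abs_eq abs_lattice_ring_eq_iff
        map_int_embed_diff map_int_embed_mult)
qed

lemma var_class_sup:
  "var_class (sup x y :: 'x::bounded_lattice) = var_class x + var_class y - var_class x * var_class y"
proof -
  have "Var (sup x y) - Var x - Var y + Var x * Var y \<in> (lattice_relations :: ('x, int) lpoly set)"
    unfolding lattice_relations_def by blast
  from lattice_relation_over[OF this] show ?thesis
    by (simp add: var_class_def times_lattice_ring.abs_eq plus_lattice_ring.abs_eq
        minus_lattice_ring.abs_eq abs_lattice_ring_eq_iff
        map_int_embed_diff map_int_embed_add map_int_embed_mult algebra_simps)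
qed

definition restrict_hom :: "(('x::bounded_lattice, 'a::comm_unital_ring) lattice_ring \<Rightarrow> 'b) \<Rightarrow> 'x \<Rightarrow> 'b" where
  "restrict_hom \<phi> x = \<phi> (var_class x)"

text \<open>Exponents are ignored because the variables are idempotent modulo the ideal. Inserting
  top keeps \<open>Inf_fin\<close> on a nonempty set and gives the monomial 1 the value top.\<close>

definition monom_inf :: "('x::bounded_lattice \<Rightarrow>\<^sub>0 nat) \<Rightarrow> 'x" where
  "monom_inf m = Inf_fin (insert Orderings.top (Poly_Mapping.keys m))"

lemma monom_inf_zero [simp]: "monom_inf 0 = Orderings.top"
  by (simp add: monom_inf_def)

lemma monom_inf_single [simp]: "monom_inf (Poly_Mapping.single x 1) = x"
  by (simp add: monom_inf_def)

text \<open>Exponents are naturals and cannot cancel, so the support of a sum is the union of the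
  supports.\<close>

lemma monom_inf_add: "monom_inf (m + n) = inf (monom_inf m) (monom_inf n)"
proof -
  have "Poly_Mapping.keys (m + n) = Poly_Mapping.keys m \<union> Poly_Mapping.keys n"
    by (auto simp: in_keys_iff lookup_add)
  then show ?thesis
    using Inf_fin.union[of "insert Orderings.top (Poly_Mapping.keys m)"
        "insert Orderings.top (Poly_Mapping.keys n)"]
    by (simp add: monom_inf_def)
qed

text \<open>The relations for meets and for top turn products of classes of variables into classes
  of meets. The property \<open>?Q\<close> therefore passes from m and n to m + n, and powers of
  single variables suffice.\<close>

lemma abs_lattice_ring_monomial:
  "abs_lattice_ring (Poly_Mapping.single m 1) = var_class (monom_inf m)"
proof -
  let ?Q = "\<lambda>m. abs_lattice_ring (Poly_Mapping.single m 1) = (var_class (monom_inf m) :: ('a, 'b) lattice_ring)"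
  have zero: "?Q 0"
    by (simp add: var_class_top one_lattice_ring_def Const_def)
  have add: "?Q (m + n)" if "?Q m" "?Q n" for m n
  proof -
    have "abs_lattice_ring (Poly_Mapping.single (m + n) 1) =
        (abs_lattice_ring (Poly_Mapping.single m 1) * abs_lattice_ring (Poly_Mapping.single n 1)
          :: ('a, 'b) lattice_ring)"
      by (simp add: times_lattice_ring.abs_eq mult_single)
    with that show ?thesis by (simp add: monom_inf_add var_class_inf)
  qed
  have single: "?Q (Poly_Mapping.single x k)" for x k
  proof (induction k)
    case (Suc k)
    have "?Q (Poly_Mapping.single x 1)" unfolding monom_inf_single by (simp add: var_class_def Var_def)
    from add[OF this Suc] show ?case by (simp flip: single_add)
  qed (simp add: zero)
  \<comment> \<open>With the support of m for S, the sum is m itself.\<close>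
  have "?Q (\<Sum>x\<in>S. Poly_Mapping.single x (Poly_Mapping.lookup m x))" for S
    by (induction S rule: infinite_finite_induct) (simp_all add: zero add single del: monom_inf_zero)
  then show ?thesis by (metis poly_mapping_sum_monomials)
qed

lemma abs_lattice_ring_sum: "abs_lattice_ring (sum h S) = (\<Sum>i\<in>S. abs_lattice_ring (h i))"
  by (induction S rule: infinite_finite_induct)
    (simp_all add: zero_lattice_ring_def flip: plus_lattice_ring.abs_eq)

text \<open>Consequently the classes of the variables span the quotient as an A-module.\<close>

lemma abs_lattice_ring_expansion:
  "abs_lattice_ring p =
    (\<Sum>m\<in>Poly_Mapping.keys p. ring_scale (Poly_Mapping.lookup p m) (var_class (monom_inf m)))"
proof -
  have "abs_lattice_ring (Poly_Mapping.single m c) = ring_scale c (var_class (monom_inf m))" for m and c :: 'b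
    by (simp add: ring_scale.abs_eq Const_mult_single flip: abs_lattice_ring_monomial)
  then show ?thesis
    by (metis (no_types, lifting) abs_lattice_ring_sum poly_mapping_sum_monomials sum.cong)
qed

section \<open>The linear form on A[X] determined by a function on X\<close>

definition linear_extension ::
  "('a \<Rightarrow> 'b \<Rightarrow> 'b) \<Rightarrow> ('x::bounded_lattice \<Rightarrow> 'b) \<Rightarrow> ('x, 'a::comm_unital_ring) lpoly \<Rightarrow> 'b::ab_group_add" where
  "linear_extension scale \<nu> p =
    (\<Sum>m\<in>Poly_Mapping.keys p. scale (Poly_Mapping.lookup p m) (\<nu> (monom_inf m)))"

context unital_module
begin

lemma linear_extension_add:
  "linear_extension scale \<nu> (p + q) = linear_extension scale \<nu> p + linear_extension scale \<nu> q"
  unfolding linear_extension_def by (rule sum_keys_add) (auto simp: scale_left_distrib)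

lemma linear_extension_single [simp]:
  "linear_extension scale \<nu> (Poly_Mapping.single m c) = scale c (\<nu> (monom_inf m))"
  by (cases "c = 0") (auto simp: linear_extension_def)

lemma linear_extension_zero [simp]: "linear_extension scale \<nu> 0 = 0"
  by (simp add: linear_extension_def)

lemma linear_extension_diff:
  "linear_extension scale \<nu> (p - q) = linear_extension scale \<nu> p - linear_extension scale \<nu> q"
  using linear_extension_add[of \<nu> "p - q" q] by simp

lemma linear_extension_sum:
  "linear_extension scale \<nu> (sum h S) = (\<Sum>i\<in>S. linear_extension scale \<nu> (h i))"
  by (induction S rule: infinite_finite_induct) (simp_all add: linear_extension_add)

lemma linear_extension_Var [simp]: "linear_extension scale \<nu> (Var x) = \<nu> x"
  using linear_extension_single[of \<nu> "Poly_Mapping.single x 1" 1]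
  unfolding monom_inf_single by (simp add: Var_def scale_one)

lemma scale_sum_right: "scale a (sum h S) = (\<Sum>i\<in>S. scale a (h i))"
  by (induction S rule: infinite_finite_induct) (simp_all add: scale_right_distrib)

lemma linear_extension_Const_mult:
  "linear_extension scale \<nu> (Const c * p) = scale c (linear_extension scale \<nu> p)"
proof -
  let ?s = "\<lambda>m. Poly_Mapping.single m (Poly_Mapping.lookup p m)"
  have "linear_extension scale \<nu> (Const c * (\<Sum>m\<in>Poly_Mapping.keys p. ?s m)) =
      scale c (linear_extension scale \<nu> (\<Sum>m\<in>Poly_Mapping.keys p. ?s m))"
    by (simp add: sum_distrib_left Const_mult_single linear_extension_sum scale_sum_right scale_scale)
  then show ?thesis by (simp only: poly_mapping_sum_monomials)
qed

text \<open>This makes the linear form descend to the quotient. Its kernel is not visibly an ideal,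
  so the proof works with the largest ideal contained in the kernel.\<close>

lemma linear_extension_lattice_ideal_over:
  assumes "is_measure \<nu>" "p \<in> lattice_ideal_over"
  shows "linear_extension scale \<nu> p = 0"
proof -
  let ?L = "linear_extension scale \<nu>"
  \<comment> \<open>\<open>?K\<close> consists of the polynomials all of whose multiples are killed;
    this condition is stable under multiplication by construction.\<close>
  let ?K = "{p. \<forall>q. ?L (q * p) = 0}"
  have K: "is_ideal ?K"
    by (auto simp: is_ideal_def right_diff_distrib linear_extension_diff simp flip: mult.assoc)
  \<comment> \<open>By additivity it suffices to test multiples by monomials.\<close>
  have KI: "p \<in> ?K" if "\<And>m c. ?L (Poly_Mapping.single m c * p) = 0" for p
  proof -
    have "?L ((\<Sum>m\<in>Poly_Mapping.keys q. Poly_Mapping.single m (Poly_Mapping.lookup q m)) * p) = 0" for q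
      by (simp add: sum_distrib_right linear_extension_sum that)
    then show ?thesis by (simp only: poly_mapping_sum_monomials) simp
  qed
  have single_Var: "Poly_Mapping.single m c * Var x = Poly_Mapping.single (m + Poly_Mapping.single x 1) c"
    for m :: "'c \<Rightarrow>\<^sub>0 nat" and c :: 'a and x
    by (simp add: Var_def mult_single)
  note L_monomial = linear_extension_single monom_inf_add monom_inf_single inf.assoc
  have "Poly_Mapping.map int_embed r \<in> ?K" if r: "r \<in> lattice_relations" for r
  proof (rule KI)
    fix m c
    consider "r = Var bot" | "r = Var Orderings.top - 1"
      | x y where "r = Var (inf x y) - Var x * Var y"
      | x y where "r = Var (sup x y) - Var x - Var y + Var x * Var y"
      using r unfolding lattice_relations_def by blast
    then show "?L (Poly_Mapping.single m c * Poly_Mapping.map int_embed r) = 0"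
    proof cases
      case 1
      with assms(1) show ?thesis
        by (simp only: map_int_embed_Var single_Var L_monomial) (simp add: is_measure_def)
    next
      case 2
      have "Poly_Mapping.single m c * Const 1 = Poly_Mapping.single m c"
        by (simp add: Const_def mult_single)
      with 2 show ?thesis
        by (simp only: map_int_embed_Var map_int_embed_one map_int_embed_diff right_diff_distrib
            single_Var L_monomial linear_extension_diff) simp
    next
      case (3 x y)
      then show ?thesis
        by (simp only: map_int_embed_Var map_int_embed_mult map_int_embed_diff right_diff_distrib
            mult.assoc[symmetric] single_Var L_monomial linear_extension_diff) simp
    next
      case (4 x y)
      \<comment> \<open>Multiplication by the monomial m becomes a meet with
        \<open>monom_inf m\<close>, which plays the role of z in
        \<open>is_measure_iff\<close>.\<close>
      have "\<nu> (inf (monom_inf m) (sup x y)) =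
          \<nu> (inf (monom_inf m) x) + \<nu> (inf (monom_inf m) y) - \<nu> (inf (monom_inf m) (inf x y))"
        using assms(1) by (simp add: is_measure_iff)
      with 4 show ?thesis
        by (simp only: map_int_embed_Var map_int_embed_mult map_int_embed_diff map_int_embed_add
            right_diff_distrib distrib_left mult.assoc[symmetric] single_Var L_monomial
            linear_extension_diff linear_extension_add)
          (simp add: scale_right_distrib scale_diff_right)
    qed
  qed
  \<comment> \<open>The ideal is generated in two stages: first over the integers, where the
    preimage of \<open>?K\<close> is an ideal containing the relations, then over A from the
    image.\<close>
  moreover have "is_ideal {r. Poly_Mapping.map int_embed r \<in> ?K}"
    using K unfolding is_ideal_def
    by (simp only: mem_Collect_eq map_int_embed_zero map_int_embed_diff map_int_embed_mult) blast
  ultimately have "lattice_ideal \<subseteq> {r. Poly_Mapping.map int_embed r \<in> ?K}"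
    unfolding lattice_ideal_def by (intro hull_minimal) auto
  then have "lattice_ideal_over \<subseteq> ?K"
    unfolding lattice_ideal_over_def using K by (intro hull_minimal) auto
  \<comment> \<open>The multiplier \<open>Const 1\<close> recovers p itself.\<close>
  with assms(2) have "?L (Const 1 * p) = 0" by blast
  then show ?thesis by (simp add: Const_one_mult)
qed

section \<open>Restriction of linear forms to the variables\<close>

lemma restrict_hom_measure:
  assumes "\<phi> \<in> Hom_over scale" shows "restrict_hom \<phi> \<in> lattice_measures"
proof -
  interpret additive \<phi> using assms by (simp add: Hom_over_def)
  \<comment> \<open>Multiplying the relation for the join of x and y by the class of z and applying
    \<phi> gives the identity of \<open>is_measure_iff\<close>.\<close>
  show ?thesis
    by (simp add: lattice_measures_def is_measure_iff restrict_hom_def var_class_bot var_class_inf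
        var_class_sup zero distrib_left right_diff_distrib add diff)
qed

text \<open>The classes of the variables span the quotient, so the restriction determines the form;
  this yields injectivity.\<close>

lemma Hom_over_expansion:
  assumes "\<phi> \<in> Hom_over scale"
  shows "\<phi> (abs_lattice_ring p) = linear_extension scale (restrict_hom \<phi>) p"
proof -
  interpret additive \<phi> using assms by (simp add: Hom_over_def)
  show ?thesis
    using assms
    by (simp add: abs_lattice_ring_expansion[of p] sum linear_extension_def restrict_hom_def Hom_over_def)
qed

lemma inj_on_restrict_hom: "inj_on restrict_hom (Hom_over scale)"
proof (rule inj_onI, rule ext)
  fix \<phi> \<psi> :: "('x::bounded_lattice, 'a) lattice_ring \<Rightarrow> 'b" and m
  assume "\<phi> \<in> Hom_over scale" "\<psi> \<in> Hom_over scale" "restrict_hom \<phi> = restrict_hom \<psi>"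
  then show "\<phi> m = \<psi> m"
    by (induction m rule: lattice_ring.abs_induct) (simp add: Hom_over_expansion)
qed

lemma restrict_hom_surj:
  assumes "\<nu> \<in> lattice_measures" shows "\<exists>\<phi>\<in>Hom_over scale. restrict_hom \<phi> = \<nu>"
proof -
  \<comment> \<open>The form is evaluated at the chosen representative. By \<open>abs\<close> any
    other representative gives the same value, as the difference lies in the ideal and is
    killed.\<close>
  define \<phi> where "\<phi> m = linear_extension scale \<nu> (rep_lattice_ring m)" for m
  have abs: "\<phi> (abs_lattice_ring p) = linear_extension scale \<nu> p" for p
  proof -
    have "rep_lattice_ring (abs_lattice_ring p) - p \<in> lattice_ideal_over"
      using Quotient3_abs_rep[OF Quotient3_lattice_ring] by (simp flip: abs_lattice_ring_eq_iff)
    with assms have "linear_extension scale \<nu> (rep_lattice_ring (abs_lattice_ring p) - p) = 0"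
      by (simp add: lattice_measures_def linear_extension_lattice_ideal_over)
    then show ?thesis by (simp add: \<phi>_def linear_extension_diff)
  qed
  have "\<phi> (m + n) = \<phi> m + \<phi> n" for m n
    by (induction m rule: lattice_ring.abs_induct, induction n rule: lattice_ring.abs_induct)
      (simp add: plus_lattice_ring.abs_eq abs linear_extension_add)
  moreover have "\<phi> (ring_scale a m) = scale a (\<phi> m)" for a m
    by (induction m rule: lattice_ring.abs_induct)
      (simp add: ring_scale.abs_eq abs linear_extension_Const_mult)
  ultimately have "\<phi> \<in> Hom_over scale" by (simp add: Hom_over_def additive_def)
  moreover have "restrict_hom \<phi> = \<nu>"
    by (simp add: fun_eq_iff restrict_hom_def var_class_def abs)
  ultimately show ?thesis by blast
qed

lemma bij_betw_restrict_hom: "bij_betw restrict_hom (Hom_over scale) lattice_measures"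
  unfolding bij_betw_def using inj_on_restrict_hom restrict_hom_measure restrict_hom_surj by blast

end

section \<open>Invariants\<close>

text \<open>\<open>lattice_action\<close> speaks of meets and joins only. The bounds are preserved
  because \<open>act g\<close> is surjective: if bot = act g x, then act g bot = act g (inf bot x)
  is a meet with bot.\<close>

lemma lattice_action_bounds:
  fixes act :: "'g \<Rightarrow> 'x::bounded_lattice \<Rightarrow> 'x"
  assumes "lattice_action G act" "g \<in> carrier G"
  shows "act g bot = bot" "act g Orderings.top = Orderings.top"
proof -
  interpret group_action G UNIV act using assms by (simp add: lattice_action_def)
  have surj: "\<exists>x. y = act g x" for y
    using surj_prop[OF assms(2)] by blast
  obtain x y where x: "bot = act g x" and y: "Orderings.top = act g y"
    using surj by blast
  have "act g (inf bot x) = inf (act g bot) (act g x)" "act g (sup Orderings.top y) = sup (act g Orderings.top) (act g y)"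
    using assms unfolding lattice_action_def by blast+
  then show "act g bot = bot" "act g Orderings.top = Orderings.top"
    by (simp_all flip: x y)
qed

lemma rename_Const [simp]: "rename f (Const c) = Const c"
  by (simp add: Const_def)

context unital_module
begin

lemma hom_act_Hom_over:
  fixes act :: "'g \<Rightarrow> 'x::bounded_lattice \<Rightarrow> 'x"
  assumes "lattice_action G act" "g \<in> carrier G" "\<phi> \<in> Hom_over scale"
  shows "hom_act G act g \<phi> \<in> Hom_over scale"
    and "restrict_hom (hom_act G act g \<phi>) x = restrict_hom \<phi> (act (inv\<^bsub>G\<^esub> g) x)"
proof -
  interpret group_action G UNIV act using assms by (simp add: lattice_action_def)
  interpret additive \<phi> using assms by (simp add: Hom_over_def)
  let ?h = "act (inv\<^bsub>G\<^esub> g)"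
  have inv: "inv\<^bsub>G\<^esub> g \<in> carrier G"
    using assms(2) group_hom group_hom.axioms(1) group.inv_closed by metis
  \<comment> \<open>As \<open>?h\<close> preserves meets, joins and bounds, the induced map can be
    computed on any representative.\<close>
  have induced: "induced ?h (abs_lattice_ring p) = abs_lattice_ring (rename ?h p)"
    for p :: "('x, 'a) lpoly"
    by (rule induced_abs)
      (use assms(1) inv in \<open>auto simp: lattice_action_bounds lattice_action_def\<close>)
  have "hom_act G act g \<phi> (m + n) = hom_act G act g \<phi> m + hom_act G act g \<phi> n" for m n
    by (induction m rule: lattice_ring.abs_induct, induction n rule: lattice_ring.abs_induct)
      (simp add: hom_act_def plus_lattice_ring.abs_eq induced rename_add add[symmetric])
  moreover have "hom_act G act g \<phi> (ring_scale a m) = scale a (hom_act G act g \<phi> m)" for a m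
  proof (induction m rule: lattice_ring.abs_induct)
    fix p :: "('x, 'a) lpoly"
    have "\<phi> (ring_scale a (abs_lattice_ring (rename ?h p))) = scale a (\<phi> (abs_lattice_ring (rename ?h p)))"
      using assms(3) by (simp add: Hom_over_def)
    then show "hom_act G act g \<phi> (ring_scale a (abs_lattice_ring p)) =
        scale a (hom_act G act g \<phi> (abs_lattice_ring p))"
      by (simp add: hom_act_def ring_scale.abs_eq induced rename_mult)
  qed
  ultimately show "hom_act G act g \<phi> \<in> Hom_over scale" by (simp add: Hom_over_def additive_def)
  show "restrict_hom (hom_act G act g \<phi>) x = restrict_hom \<phi> (?h x)"
    by (simp add: restrict_hom_def hom_act_def var_class_def induced)
qed

text \<open>Both \<phi> and its translate by g are linear forms, and restriction is injective on
  these, so being fixed can be tested on the variables.\<close>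

lemma fixed_homs_iff_invariant:
  assumes "lattice_action G act" "\<phi> \<in> Hom_over scale"
  shows "\<phi> \<in> fixed_homs G act (Hom_over scale) \<longleftrightarrow> restrict_hom \<phi> \<in> invariant_measures G act"
proof -
  interpret group_action G UNIV act using assms by (simp add: lattice_action_def)
  interpret group G using group_hom group_hom.axioms(1) by blast
  have "hom_act G act g \<phi> = \<phi> \<longleftrightarrow> (\<forall>x. restrict_hom \<phi> (act (inv\<^bsub>G\<^esub> g) x) = restrict_hom \<phi> x)"
    if "g \<in> carrier G" for g
    using hom_act_Hom_over[OF assms(1) that assms(2)] inj_on_restrict_hom assms(2)
    by (metis (no_types, lifting) ext inj_on_def)
  \<comment> \<open>The inverse disappears because g and its inverse run through the same
    group.\<close>
  then show ?thesis
    using assms(2) restrict_hom_measure[OF assms(2)] inv_closed inv_inv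
    by (simp add: fixed_homs_def invariant_measures_def) (metis inv_closed inv_inv)
qed

lemma bij_betw_restrict_hom_fixed:
  fixes act :: "'g \<Rightarrow> 'x::bounded_lattice \<Rightarrow> 'x"
  assumes "lattice_action G act"
  shows "bij_betw restrict_hom (fixed_homs G act (Hom_over scale)) (invariant_measures G act)"
proof (rule bij_betw_subset[OF bij_betw_restrict_hom])
  show "fixed_homs G act (Hom_over scale) \<subseteq> Hom_over scale"
    by (auto simp: fixed_homs_def)
  show "restrict_hom ` fixed_homs G act (Hom_over scale) = invariant_measures G act"
  proof (intro equalityI subsetI)
    fix \<nu> assume "\<nu> \<in> restrict_hom ` fixed_homs G act (Hom_over scale)"
    then show "\<nu> \<in> invariant_measures G act"
      using fixed_homs_iff_invariant[OF assms] by (auto simp: fixed_homs_def)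
  next
    fix \<nu> :: "'x \<Rightarrow> 'b" assume \<nu>: "\<nu> \<in> invariant_measures G act"
    then obtain \<phi> where "\<phi> \<in> Hom_over scale" "restrict_hom \<phi> = \<nu>"
      using restrict_hom_surj[of \<nu>] by (auto simp: invariant_measures_def)
    with \<nu> show "\<nu> \<in> restrict_hom ` fixed_homs G act (Hom_over scale)"
      using fixed_homs_iff_invariant[OF assms] by blast
  qed
qed

end

theorem theorem1:
  fixes G :: "('g, 'z) monoid_scheme"
    and act :: "'g \<Rightarrow> 'x::bounded_lattice \<Rightarrow> 'x"
    and scale :: "'a::comm_unital_ring \<Rightarrow> 'b::ab_group_add \<Rightarrow> 'b"
  assumes "lattice_action G act"
    and "unital_module scale"
  shows
    "module_isomorphic
       (pointwise scale) (lattice_measures :: ('x \<Rightarrow> 'b) set)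
       (pointwise scale) (Hom_int :: (('x, int) lattice_ring \<Rightarrow> 'b) set) \<and>
     module_isomorphic
       (pointwise scale) (Hom_int :: (('x, int) lattice_ring \<Rightarrow> 'b) set)
       (pointwise scale) (Hom_over scale :: (('x, 'a) lattice_ring \<Rightarrow> 'b) set) \<and>
     module_isomorphic
       (pointwise scale) (invariant_measures G act :: ('x \<Rightarrow> 'b) set)
       (pointwise scale) (fixed_homs G act Hom_int :: (('x, int) lattice_ring \<Rightarrow> 'b) set) \<and>
     module_isomorphic
       (pointwise scale) (fixed_homs G act Hom_int :: (('x, int) lattice_ring \<Rightarrow> 'b) set)
       (pointwise scale) (fixed_homs G act (Hom_over scale) :: (('x, 'a) lattice_ring \<Rightarrow> 'b) set)"
proof -
  interpret B: unital_module scale by fact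
  interpret Z: unital_module "int_scale :: int \<Rightarrow> 'b \<Rightarrow> 'b" by (rule unital_module_int_scale)
  have over: "module_isomorphic
      (pointwise scale) (Hom_over scale :: (('x, 'a) lattice_ring \<Rightarrow> 'b) set)
      (pointwise scale) (lattice_measures :: ('x \<Rightarrow> 'b) set)"
    using B.submodule_Hom_over B.submodule_lattice_measures B.bij_betw_restrict_hom
    unfolding module_isomorphic_def
    by (intro conjI exI[of _ restrict_hom]) (auto simp: restrict_hom_def pointwise_def fun_eq_iff)
  \<comment> \<open>Bijectivity comes from the integer case, while the module structure on both
    sides comes from \<open>scale\<close>; restriction commutes with any pointwise
    operation.\<close>
  have int: "module_isomorphic
      (pointwise scale) (Hom_int :: (('x, int) lattice_ring \<Rightarrow> 'b) set)
      (pointwise scale) (lattice_measures :: ('x \<Rightarrow> 'b) set)"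
    using B.submodule_Hom_int B.submodule_lattice_measures Z.bij_betw_restrict_hom
    unfolding module_isomorphic_def Hom_int_eq_Hom_over
    by (intro conjI exI[of _ restrict_hom]) (auto simp: restrict_hom_def pointwise_def fun_eq_iff)
  have over_fixed: "module_isomorphic
      (pointwise scale) (fixed_homs G act (Hom_over scale) :: (('x, 'a) lattice_ring \<Rightarrow> 'b) set)
      (pointwise scale) (invariant_measures G act :: ('x \<Rightarrow> 'b) set)"
    using B.submodule_fixed_homs[OF B.submodule_Hom_over] B.submodule_invariant_measures
      B.bij_betw_restrict_hom_fixed[OF assms(1)]
    unfolding module_isomorphic_def
    by (intro conjI exI[of _ restrict_hom]) (auto simp: restrict_hom_def pointwise_def fun_eq_iff)
  have int_fixed: "module_isomorphic
      (pointwise scale) (fixed_homs G act Hom_int :: (('x, int) lattice_ring \<Rightarrow> 'b) set)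
      (pointwise scale) (invariant_measures G act :: ('x \<Rightarrow> 'b) set)"
    using B.submodule_fixed_homs[OF B.submodule_Hom_int] B.submodule_invariant_measures
      Z.bij_betw_restrict_hom_fixed[OF assms(1)]
    unfolding module_isomorphic_def Hom_int_eq_Hom_over
    by (intro conjI exI[of _ restrict_hom]) (auto simp: restrict_hom_def pointwise_def fun_eq_iff)
  \<comment> \<open>The isomorphism between the two modules of homomorphisms passes through the
    measures.\<close>
  show ?thesis
    by (intro conjI module_isomorphic_sym[OF int] module_isomorphic_sym[OF int_fixed]
        module_isomorphic_trans[OF int module_isomorphic_sym[OF over]]
        module_isomorphic_trans[OF int_fixed module_isomorphic_sym[OF over_fixed]])
qed

end
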